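(* Let $A$ and $B$ be nearrings, and let $\psi:B\to\mathrm{Aut}(A,+)$, $b\mapsto\psi_b$; $\alpha:B\to\mathrm{Map}(A^2,A)$, $b\mapsto\alpha_b$; and $\beta:B^2\to\mathrm{Map}(A,A)$, $(b_1,b_2)\mapsto\beta_{b_1,b_2}$, be functions such that for all $b,b_1,b_2\in B$ and $a,a_1,a_2\in A$: $\alpha_b(a_1+a_2,a)=\alpha_b(a_1,a)+\alpha_b(a_2,a)$; $\alpha_0(a_1,a_2)=a_1a_2$; $\beta_{0,b}=0$ (the zero map) and $\beta_{b_1,b_2}(0)=0$. Let $A\boxtimes B$ be the set $A\times B$ with the operations $$(a_1,b_1)+(a_2,b_2)=(a_1+\psi_{b_1}(a_2),\,b_1+b_2),\qquad (a_1,b_1)(a_2,b_2)=(\alpha_{b_2}(a_1,a_2)+\beta_{b_1,b_2}(a_2),\,b_1b_2)$$ (that is, the $E$-sum of $A$ and $B$ with both factor systems $[-,-]$ and $\langle-,-\rangle$ equal to $0$). Then $A\boxtimes B$ is a semidirect sum of $A$ and $B$ (with $A$ and $B$ identified with $(A,0)=\{(a,0)\mid a\in A\}$ and $(0,B)=\{(0,b)\mid b\in B\}$ respectively) if and only if the following conditions hold for all $a_1,a_2,a_3\in A$ and $b_1,b_2,b_3\in B$: $(G_2)$ $\psi_{b_1}\circ\psi_{b_2}=\psi_{b_1+b_2}$; $(A_1)$ $\alpha_{b_3}(\beta_{b_1,b_2}(a_2),a_3)+\beta_{b_1b_2,b_3}(a_3)=\beta_{b_1,b_2b_3}\big(\alpha_{b_3}(a_2,a_3)+\beta_{b_2,b_3}(a_3)\big)$;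 $(A_2)$ $\alpha_{b_3}(\alpha_{b_2}(a_1,a_2),a_3)=\alpha_{b_2b_3}\big(a_1,\alpha_{b_3}(a_2,a_3)+\beta_{b_2,b_3}(a_3)\big)$; $(D_1)$ $\beta_{b_1+b_2,b_3}=\beta_{b_1,b_3}+\psi_{b_1b_3}\circ\beta_{b_2,b_3}$ (pointwise sum of maps); $(D_2)$ $\alpha_{b_3}(\psi_{b_1}(a_2),a_3)+\beta_{b_1,b_3}(a_3)=\beta_{b_1,b_3}(a_3)+\psi_{b_1b_3}(\alpha_{b_3}(a_2,a_3))$.
   Context: A nearring is a set $N$ with operations $+,\cdot$ such that $(N,+)$ is a (not necessarily abelian) group, $(N,\cdot)$ is a semigroup, and $(x+y)z=xz+yz$ for all $x,y,z\in N$ (right distributivity). It need not be zero-symmetric. An ideal $I$ of $N$ is a normal subgroup of $(N,+)$ with $in\in I$ and $n(i+m)-nm\in I$ for all $i\in I$, $n,m\in N$. $\mathrm{Aut}(A,+)$ is the set of automorphisms of the additive group of $A$; $\mathrm{Map}(X,Y)$ is the set of all functions $X\to Y$; $X^2=X\times X$. A nearring $N$ is the (internal) semidirect sum of two nearrings $A$ and $B$ if $A$ is an ideal of $N$, $B$ is a subnearring of $N$, $N=A+B$, $A\cap B=0$ and $N/A\cong B$. In particular, "$A\boxtimes B$ is a semidirect sum of $A$ and $B$" includes that $A\boxtimes B$ is a nearring; $A$ and $B$ are regarded inside $A\boxtimes B$ via the maps $a\mapsto(a,0)$ and $b\mapsto(0,b)$, which are required to be nearring embeddings (outer semidirect sum).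 *)

theory Defs
  imports "HOL-Algebra.QuotRing"
begin

text \<open>
  Nearrings are carried by the record type of HOL-Algebra rings. A nearring need not have a
  multiplicative identity, so the field \<open>one\<close> is ignored throughout; in particular the library's
  \<open>ring_hom\<close>, which preserves \<open>one\<close>, is not used.
\<close>

locale nearring =
  fixes N (structure)
  assumes add_group: "group (add_monoid N)"
    and mult_closed: "\<lbrakk>x \<in> carrier N; y \<in> carrier N\<rbrakk> \<Longrightarrow> x \<otimes> y \<in> carrier N"
    and mult_assoc: "\<lbrakk>x \<in> carrier N; y \<in> carrier N; z \<in> carrier N\<rbrakk>
      \<Longrightarrow> (x \<otimes> y) \<otimes> z = x \<otimes> (y \<otimes> z)"
    and right_distrib: "\<lbrakk>x \<in> carrier N; y \<in> carrier N; z \<in> carrier N\<rbrakk>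
      \<Longrightarrow> (x \<oplus> y) \<otimes> z = x \<otimes> z \<oplus> y \<otimes> z"

definition nearring_ideal :: "'a set \<Rightarrow> ('a, 'm) ring_scheme \<Rightarrow> bool" where
  "nearring_ideal I N \<longleftrightarrow>
     I \<lhd> add_monoid N \<and>
     (\<forall>i\<in>I. \<forall>n\<in>carrier N. i \<otimes>\<^bsub>N\<^esub> n \<in> I) \<and>
     (\<forall>i\<in>I. \<forall>n\<in>carrier N. \<forall>m\<in>carrier N.
        n \<otimes>\<^bsub>N\<^esub> (i \<oplus>\<^bsub>N\<^esub> m) \<ominus>\<^bsub>N\<^esub> n \<otimes>\<^bsub>N\<^esub> m \<in> I)"

definition subnearring :: "'a set \<Rightarrow> ('a, 'm) ring_scheme \<Rightarrow> bool" where
  "subnearring S N \<longleftrightarrow>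
     subgroup S (add_monoid N) \<and> (\<forall>x\<in>S. \<forall>y\<in>S. x \<otimes>\<^bsub>N\<^esub> y \<in> S)"

text \<open>Below, \<open>hom R S\<close> is the set of maps that preserve multiplication.\<close>

definition nearring_hom :: "('a, 'm) ring_scheme \<Rightarrow> ('b, 'n) ring_scheme \<Rightarrow> ('a \<Rightarrow> 'b) set" where
  "nearring_hom R S = hom (add_monoid R) (add_monoid S) \<inter> hom R S"

definition nearring_embedding ::
    "('a, 'm) ring_scheme \<Rightarrow> ('b, 'n) ring_scheme \<Rightarrow> ('a \<Rightarrow> 'b) \<Rightarrow> bool" where
  "nearring_embedding R S h \<longleftrightarrow> h \<in> nearring_hom R S \<and> inj_on h (carrier R)"

definition nearring_isomorphic :: "('a, 'm) ring_scheme \<Rightarrow> ('b, 'n) ring_scheme \<Rightarrow> bool" where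
  "nearring_isomorphic R S \<longleftrightarrow>
     (\<exists>h\<in>nearring_hom R S. bij_betw h (carrier R) (carrier S))"

text \<open>
  The library's \<open>N Quot A\<close> is the set of additive cosets of \<open>A\<close> with the operations
  \<open>(A + x) + (A + y) = A + (x + y)\<close> and \<open>(A + x)(A + y) = A + xy\<close>; its definition does not
  need addition to be commutative.
\<close>

definition internal_semidirect_sum :: "('a, 'm) ring_scheme \<Rightarrow> 'a set \<Rightarrow> 'a set \<Rightarrow> bool" where
  "internal_semidirect_sum N A B \<longleftrightarrow>
     nearring N \<and> nearring_ideal A N \<and> subnearring B N \<and>
     carrier N = A <+>\<^bsub>N\<^esub> B \<and> A \<inter> B = {\<zero>\<^bsub>N\<^esub>} \<and>
     nearring_isomorphic (N Quot A) (N\<lparr>carrier := B\<rparr>)"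

definition outer_semidirect_sum ::
    "('c, 'k) ring_scheme \<Rightarrow> ('a, 'm) ring_scheme \<Rightarrow> ('a \<Rightarrow> 'c) \<Rightarrow>
     ('b, 'n) ring_scheme \<Rightarrow> ('b \<Rightarrow> 'c) \<Rightarrow> bool" where
  "outer_semidirect_sum N A f B g \<longleftrightarrow>
     nearring_embedding A N f \<and> nearring_embedding B N g \<and>
     internal_semidirect_sum N (f ` carrier A) (g ` carrier B)"

definition boxtimes ::
    "('a, 'm) ring_scheme \<Rightarrow> ('b, 'n) ring_scheme \<Rightarrow> ('b \<Rightarrow> 'a \<Rightarrow> 'a) \<Rightarrow>
     ('b \<Rightarrow> 'a \<times> 'a \<Rightarrow> 'a) \<Rightarrow> ('b \<times> 'b \<Rightarrow> 'a \<Rightarrow> 'a) \<Rightarrow> ('a \<times> 'b) ring" where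
  "boxtimes A B \<psi> \<alpha> \<beta> =
     \<lparr>carrier = carrier A \<times> carrier B,
      mult = (\<lambda>(a\<^sub>1, b\<^sub>1) (a\<^sub>2, b\<^sub>2).
        (\<alpha> b\<^sub>2 (a\<^sub>1, a\<^sub>2) \<oplus>\<^bsub>A\<^esub> \<beta> (b\<^sub>1, b\<^sub>2) a\<^sub>2, b\<^sub>1 \<otimes>\<^bsub>B\<^esub> b\<^sub>2)),
      one = undefined,
      zero = (\<zero>\<^bsub>A\<^esub>, \<zero>\<^bsub>B\<^esub>),
      add = (\<lambda>(a\<^sub>1, b\<^sub>1) (a\<^sub>2, b\<^sub>2). (a\<^sub>1 \<oplus>\<^bsub>A\<^esub> \<psi> b\<^sub>1 a\<^sub>2, b\<^sub>1 \<oplus>\<^bsub>B\<^esub> b\<^sub>2))\<rparr>"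

end

theory Submission
  imports Defs
begin

text \<open>
  The equivalence rests on two independent observations.

  First, a retraction splits a nearring: an idempotent endomorphism \<open>e\<close> of a nearring \<open>N\<close> exhibits \<open>N\<close>
  as the semidirect sum of its kernel and its image, because \<open>x = (x - e x) + e x\<close> and because
  \<open>N / ker e \<cong> im e\<close> by the homomorphism theorem (\<open>internal_semidirect_sum_of_retraction\<close>). On
  \<open>A \<boxtimes> B\<close> the map \<open>(a, b) \<mapsto> (0, b)\<close> preserves both operations merely because \<open>\<psi>\<^sub>b(0) = 0\<close>,
  \<open>\<alpha>\<^sub>b(0, a) = 0\<close> and \<open>\<beta>(0) = 0\<close>; its kernel is \<open>(A, 0)\<close> and its image \<open>(0, B)\<close>. So \<open>A \<boxtimes> B\<close> is a
  semidirect sum as soon as it is a nearring (\<open>outer_semidirect_sum_boxtimes\<close>).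

  Second, the nearring laws of \<open>A \<boxtimes> B\<close> hold in the \<open>B\<close>-component because \<open>B\<close> is a nearring. In the
  \<open>A\<close>-component, associativity of addition is \<open>(G\<^sub>2)\<close>, which also provides the neutral element and
  inverses. Associativity of multiplication is, by additivity of \<open>\<alpha>\<close>, the sum of \<open>(A\<^sub>2)\<close> and \<open>(A\<^sub>1)\<close>;
  these are recovered by putting \<open>b\<^sub>1 = 0\<close>, which kills every \<open>\<beta>\<close> with \<open>b\<^sub>1\<close> in its index, and
  \<open>a\<^sub>1 = 0\<close>, which kills every \<open>\<alpha>\<close> with \<open>a\<^sub>1\<close> in its first argument. After cancelling
  \<open>\<alpha>\<^bsub>b\<^sub>3\<^esub>(a\<^sub>1, a\<^sub>3)\<close>, right distributivity is a combination of \<open>(D\<^sub>1)\<close> and \<open>(D\<^sub>2)\<close>, recovered by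
  \<open>a\<^sub>2 = 0\<close> and \<open>b\<^sub>2 = 0\<close> (\<open>sum_conditions_if_nearring\<close>, \<open>nearring_if_sum_conditions\<close>).
\<close>

section \<open>Homomorphisms of nearrings and retractions\<close>

sublocale nearring \<subseteq> add: group "add_monoid N"
  rewrites "carrier (add_monoid N) = carrier N"
    and "mult (add_monoid N) = add N"
    and "one (add_monoid N) = zero N"
    and "m_inv (add_monoid N) = a_inv N"
  by (rule add_group) (simp_all add: a_inv_def)

context nearring
begin

lemma zero_mult: "x \<in> carrier N \<Longrightarrow> \<zero> \<otimes> x = \<zero>"
  using right_distrib[of \<zero> \<zero> x] mult_closed[of \<zero> x]
  by (metis add.l_cancel_one add.one_closed add.r_one)

lemma nearring_subnearring:
  assumes "subnearring S N"
  shows "nearring (N\<lparr>carrier := S\<rparr>)"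
proof -
  have sub: "subgroup S (add_monoid N)" and mult: "\<And>x y. x \<in> S \<Longrightarrow> y \<in> S \<Longrightarrow> x \<otimes> y \<in> S"
    using assms by (auto simp: subnearring_def)
  have "S \<subseteq> carrier N"
    using subgroup.subset[OF sub] by simp
  moreover have "group (add_monoid (N\<lparr>carrier := S\<rparr>))"
    using group.subgroup_imp_group[OF add_group sub] by simp
  ultimately show ?thesis
    by (intro nearring.intro) (auto simp: mult intro!: mult_assoc right_distrib)
qed

end

locale nearring_homomorphism = N: nearring N + M: nearring M
  for N :: "('a, 'm) ring_scheme" and M :: "('b, 'n) ring_scheme" +
  fixes h :: "'a \<Rightarrow> 'b"
  assumes hom: "h \<in> nearring_hom N M"
begin

lemma hom_closed: "x \<in> carrier N \<Longrightarrow> h x \<in> carrier M"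
  using hom by (auto simp: nearring_hom_def hom_def)

lemma hom_add: "\<lbrakk>x \<in> carrier N; y \<in> carrier N\<rbrakk> \<Longrightarrow> h (x \<oplus>\<^bsub>N\<^esub> y) = h x \<oplus>\<^bsub>M\<^esub> h y"
  using hom by (auto simp: nearring_hom_def hom_def)

lemma hom_mult: "\<lbrakk>x \<in> carrier N; y \<in> carrier N\<rbrakk> \<Longrightarrow> h (x \<otimes>\<^bsub>N\<^esub> y) = h x \<otimes>\<^bsub>M\<^esub> h y"
  using hom by (auto simp: nearring_hom_def hom_def)

lemma additive_hom: "group_hom (add_monoid N) (add_monoid M) h"
  using hom N.add_group M.add_group
  by (simp add: group_hom_def group_hom_axioms_def nearring_hom_def)

lemma hom_zero: "h \<zero>\<^bsub>N\<^esub> = \<zero>\<^bsub>M\<^esub>"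
  using group_hom.hom_one[OF additive_hom] by simp

lemma hom_neg: "x \<in> carrier N \<Longrightarrow> h (\<ominus>\<^bsub>N\<^esub> x) = \<ominus>\<^bsub>M\<^esub> h x"
  using group_hom.hom_inv[OF additive_hom] by (simp add: a_inv_def)

lemma hom_minus: "\<lbrakk>x \<in> carrier N; y \<in> carrier N\<rbrakk> \<Longrightarrow> h (x \<ominus>\<^bsub>N\<^esub> y) = h x \<ominus>\<^bsub>M\<^esub> h y"
  by (simp add: a_minus_def hom_add hom_neg)

lemma mem_a_kernel: "x \<in> a_kernel N M h \<longleftrightarrow> x \<in> carrier N \<and> h x = \<zero>\<^bsub>M\<^esub>"
  by (simp add: a_kernel_def kernel_def)

lemma nearring_ideal_kernel: "nearring_ideal (a_kernel N M h) N"
  unfolding nearring_ideal_def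
proof (intro conjI ballI)
  show "a_kernel N M h \<lhd> add_monoid N"
    unfolding a_kernel_def by (rule group_hom.normal_kernel[OF additive_hom])
next
  fix i n assume "i \<in> a_kernel N M h" "n \<in> carrier N"
  then show "i \<otimes>\<^bsub>N\<^esub> n \<in> a_kernel N M h"
    by (simp add: mem_a_kernel hom_mult hom_closed N.mult_closed M.zero_mult)
next
  fix i n m assume "i \<in> a_kernel N M h" "n \<in> carrier N" "m \<in> carrier N"
  then show "n \<otimes>\<^bsub>N\<^esub> (i \<oplus>\<^bsub>N\<^esub> m) \<ominus>\<^bsub>N\<^esub> n \<otimes>\<^bsub>N\<^esub> m \<in> a_kernel N M h"
    by (simp add: mem_a_kernel hom_mult hom_closed hom_minus hom_add N.mult_closed M.mult_closed
        a_minus_def[of N "n \<otimes>\<^bsub>N\<^esub> (i \<oplus>\<^bsub>N\<^esub> m)" "n \<otimes>\<^bsub>N\<^esub> m"] hom_neg M.add.r_inv)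
qed

lemma subnearring_image: "subnearring (h ` carrier N) M"
  unfolding subnearring_def
proof (intro conjI ballI)
  show "subgroup (h ` carrier N) (add_monoid M)"
    using group_hom.img_is_subgroup[OF additive_hom] by simp
next
  fix x y assume "x \<in> h ` carrier N" "y \<in> h ` carrier N"
  then show "x \<otimes>\<^bsub>M\<^esub> y \<in> h ` carrier N"
    by (auto simp: hom_mult[symmetric] N.mult_closed)
qed

text \<open>
  The homomorphism theorem. Its additive half is the one for groups, with the same isomorphism:
  a coset \<open>X\<close> of the kernel goes to the only element of \<open>h ` X\<close>. The product of two cosets is defined
  as a union of cosets, so its image is again computed elementwise.
\<close>

lemma quotient_by_kernel_isomorphic:
  assumes surj: "h ` carrier N = carrier M"
  shows "nearring_isomorphic (N Quot a_kernel N M h) M"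
proof -
  let ?K = "a_kernel N M h"
  let ?f = "\<lambda>X. the_elem (h ` X)"
  have add_Quot: "add_monoid (N Quot ?K) = add_monoid N Mod kernel (add_monoid N) (add_monoid M) h"
    by (simp add: FactRing_def FactGroup_def A_RCOSETS_def set_add_def a_kernel_def)
  have iso: "?f \<in> iso (add_monoid (N Quot ?K)) (add_monoid M)"
    unfolding add_Quot
    by (rule group_hom.FactGroup_iso_set[OF additive_hom]) (simp add: surj)
  have coset: "\<exists>x\<in>carrier N. x \<in> X \<and> X \<subseteq> {y \<in> carrier N. h y = h x}"
    if "X \<in> carrier (N Quot ?K)" for X
  proof -
    from that obtain x where x: "x \<in> carrier N" and X: "X = (\<Union>k\<in>?K. {k \<oplus>\<^bsub>N\<^esub> x})"
      by (auto simp: FactRing_def A_RCOSETS_def RCOSETS_def r_coset_def)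
    have "\<zero>\<^bsub>N\<^esub> \<in> ?K"
      by (simp add: mem_a_kernel hom_zero)
    then have "x \<in> X"
      unfolding X using x by force
    moreover have "X \<subseteq> {y \<in> carrier N. h y = h x}"
      using x by (auto simp: X mem_a_kernel hom_add hom_closed)
    ultimately show ?thesis
      using x by blast
  qed
  have f: "?f X = h x" if "x \<in> X" "X \<subseteq> {y \<in> carrier N. h y = h x}" for X x
  proof -
    have "h ` X = {h x}" using that by auto
    then show ?thesis by simp
  qed
  have "?f \<in> hom (N Quot ?K) M"
  proof (rule homI)
    fix X assume "X \<in> carrier (N Quot ?K)"
    then show "?f X \<in> carrier M"
      using coset f hom_closed by metis
  next
    fix X Y assume X: "X \<in> carrier (N Quot ?K)" and Y: "Y \<in> carrier (N Quot ?K)"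
    obtain x where x: "x \<in> carrier N" "x \<in> X" "X \<subseteq> {u \<in> carrier N. h u = h x}"
      using coset[OF X] by auto
    obtain y where y: "y \<in> carrier N" "y \<in> Y" "Y \<subseteq> {u \<in> carrier N. h u = h y}"
      using coset[OF Y] by auto
    have XY: "X \<otimes>\<^bsub>N Quot ?K\<^esub> Y = (\<Union>u\<in>X. \<Union>v\<in>Y. \<Union>k\<in>?K. {k \<oplus>\<^bsub>N\<^esub> (u \<otimes>\<^bsub>N\<^esub> v)})"
      by (simp add: FactRing_def rcoset_mult_def a_r_coset_def r_coset_def)
    have "\<zero>\<^bsub>N\<^esub> \<in> ?K"
      by (simp add: mem_a_kernel hom_zero)
    then have "\<zero>\<^bsub>N\<^esub> \<oplus>\<^bsub>N\<^esub> (x \<otimes>\<^bsub>N\<^esub> y) \<in> X \<otimes>\<^bsub>N Quot ?K\<^esub> Y"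
      unfolding XY using x(2) y(2) by blast
    then have 1: "x \<otimes>\<^bsub>N\<^esub> y \<in> X \<otimes>\<^bsub>N Quot ?K\<^esub> Y"
      using x y by (simp add: N.mult_closed)
    have 2: "h (k \<oplus>\<^bsub>N\<^esub> (u \<otimes>\<^bsub>N\<^esub> v)) = h (x \<otimes>\<^bsub>N\<^esub> y) \<and> k \<oplus>\<^bsub>N\<^esub> (u \<otimes>\<^bsub>N\<^esub> v) \<in> carrier N"
      if "u \<in> X" "v \<in> Y" "k \<in> ?K" for u v k
    proof -
      have "u \<in> carrier N" "h u = h x" "v \<in> carrier N" "h v = h y"
        using that x y by auto
      then show ?thesis
        using x y that
        by (simp add: mem_a_kernel hom_add hom_mult hom_closed N.mult_closed M.mult_closed)
    qed
    have "?f (X \<otimes>\<^bsub>N Quot ?K\<^esub> Y) = h (x \<otimes>\<^bsub>N\<^esub> y)"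
      by (rule f[OF 1]) (auto simp: XY dest: 2)
    then show "?f (X \<otimes>\<^bsub>N Quot ?K\<^esub> Y) = ?f X \<otimes>\<^bsub>M\<^esub> ?f Y"
      using f[OF x(2,3)] f[OF y(2,3)] x y by (simp add: hom_mult)
  qed
  with iso have "?f \<in> nearring_hom (N Quot ?K) M"
    and "bij_betw ?f (carrier (N Quot ?K)) (carrier M)"
    by (simp_all add: nearring_hom_def iso_def)
  then show ?thesis
    unfolding nearring_isomorphic_def by blast
qed

end

text \<open>
  The complement of the image is reached by \<open>x \<mapsto> x - e x\<close>, which idempotence sends into the kernel;
  idempotence also makes \<open>e\<close> the identity on its image, hence the trivial intersection.
\<close>

lemma internal_semidirect_sum_of_retraction:
  assumes N: "nearring N" and e: "e \<in> nearring_hom N N"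
    and idem: "\<And>x. x \<in> carrier N \<Longrightarrow> e (e x) = e x"
  shows "internal_semidirect_sum N (a_kernel N N e) (e ` carrier N)"
proof -
  interpret nearring_homomorphism N N e
    using N e by (simp add: nearring_homomorphism_def nearring_homomorphism_axioms_def)
  let ?K = "a_kernel N N e" and ?S = "e ` carrier N"
  let ?M = "N\<lparr>carrier := ?S\<rparr>"
  have sum: "carrier N = ?K <+>\<^bsub>N\<^esub> ?S"
  proof (intro equalityI subsetI)
    fix x assume x: "x \<in> carrier N"
    let ?k = "x \<oplus>\<^bsub>N\<^esub> (\<ominus>\<^bsub>N\<^esub> e x)"
    have "?k \<in> ?K"
      using x by (simp add: mem_a_kernel hom_add hom_neg hom_closed idem N.add.r_inv)
    moreover have "x = ?k \<oplus>\<^bsub>N\<^esub> e x"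
      using x by (simp add: N.add.m_assoc hom_closed N.add.l_inv)
    ultimately show "x \<in> ?K <+>\<^bsub>N\<^esub> ?S"
      using x by (force simp: set_add_def set_mult_def)
  next
    fix x assume "x \<in> ?K <+>\<^bsub>N\<^esub> ?S"
    then show "x \<in> carrier N"
      by (auto simp: set_add_def set_mult_def mem_a_kernel hom_closed)
  qed
  have int: "?K \<inter> ?S = {\<zero>\<^bsub>N\<^esub>}"
  proof (intro equalityI subsetI)
    fix x assume "x \<in> ?K \<inter> ?S"
    then show "x \<in> {\<zero>\<^bsub>N\<^esub>}"
      by (auto simp: mem_a_kernel idem)
  next
    fix x assume "x \<in> {\<zero>\<^bsub>N\<^esub>}"
    then show "x \<in> ?K \<inter> ?S"
      using image_eqI[of "\<zero>\<^bsub>N\<^esub>" e "\<zero>\<^bsub>N\<^esub>" "carrier N"] by (simp add: mem_a_kernel hom_zero)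
  qed
  have M: "nearring ?M"
    by (rule N.nearring_subnearring[OF subnearring_image])
  have "e \<in> nearring_hom N ?M"
    by (auto simp: nearring_hom_def hom_def hom_add hom_mult)
  then have "nearring_isomorphic (N Quot a_kernel N ?M e) ?M"
    by (intro nearring_homomorphism.quotient_by_kernel_isomorphic)
      (simp_all add: nearring_homomorphism_def nearring_homomorphism_axioms_def N M)
  moreover have "a_kernel N ?M e = ?K"
    by (simp add: a_kernel_def kernel_def)
  ultimately show ?thesis
    unfolding internal_semidirect_sum_def
    using N nearring_ideal_kernel subnearring_image sum int by simp
qed

section \<open>The sum of two nearrings with trivial factor systems\<close>

locale split_sum = A: nearring A + B: nearring B
  for A :: "('a, 'm) ring_scheme" and B :: "('b, 'n) ring_scheme" +
  fixes \<psi> :: "'b \<Rightarrow> 'a \<Rightarrow> 'a"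
    and \<alpha> :: "'b \<Rightarrow> 'a \<times> 'a \<Rightarrow> 'a"
    and \<beta> :: "'b \<times> 'b \<Rightarrow> 'a \<Rightarrow> 'a"
  assumes psi_iso: "\<psi> \<in> carrier B \<rightarrow> iso (add_monoid A) (add_monoid A)"
    and alpha_maps: "\<alpha> \<in> carrier B \<rightarrow> (carrier A \<times> carrier A \<rightarrow> carrier A)"
    and beta_maps: "\<beta> \<in> carrier B \<times> carrier B \<rightarrow> (carrier A \<rightarrow> carrier A)"
    and alpha_add: "\<lbrakk>b \<in> carrier B; a\<^sub>1 \<in> carrier A; a\<^sub>2 \<in> carrier A; a \<in> carrier A\<rbrakk> \<Longrightarrow>
           \<alpha> b (a\<^sub>1 \<oplus>\<^bsub>A\<^esub> a\<^sub>2, a) = \<alpha> b (a\<^sub>1, a) \<oplus>\<^bsub>A\<^esub> \<alpha> b (a\<^sub>2, a)"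
    and alpha_zero_index:
      "\<lbrakk>a\<^sub>1 \<in> carrier A; a\<^sub>2 \<in> carrier A\<rbrakk> \<Longrightarrow> \<alpha> \<zero>\<^bsub>B\<^esub> (a\<^sub>1, a\<^sub>2) = a\<^sub>1 \<otimes>\<^bsub>A\<^esub> a\<^sub>2"
    and beta_zero_index: "\<lbrakk>b \<in> carrier B; a \<in> carrier A\<rbrakk> \<Longrightarrow> \<beta> (\<zero>\<^bsub>B\<^esub>, b) a = \<zero>\<^bsub>A\<^esub>"
    and beta_zero: "\<lbrakk>b\<^sub>1 \<in> carrier B; b\<^sub>2 \<in> carrier B\<rbrakk> \<Longrightarrow> \<beta> (b\<^sub>1, b\<^sub>2) \<zero>\<^bsub>A\<^esub> = \<zero>\<^bsub>A\<^esub>"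
begin

abbreviation S where "S \<equiv> boxtimes A B \<psi> \<alpha> \<beta>"

lemma carrier_S: "carrier S = carrier A \<times> carrier B"
  by (simp add: boxtimes_def)

lemma zero_S: "\<zero>\<^bsub>S\<^esub> = (\<zero>\<^bsub>A\<^esub>, \<zero>\<^bsub>B\<^esub>)"
  by (simp add: boxtimes_def)

lemma add_S: "(a\<^sub>1, b\<^sub>1) \<oplus>\<^bsub>S\<^esub> (a\<^sub>2, b\<^sub>2) = (a\<^sub>1 \<oplus>\<^bsub>A\<^esub> \<psi> b\<^sub>1 a\<^sub>2, b\<^sub>1 \<oplus>\<^bsub>B\<^esub> b\<^sub>2)"
  by (simp add: boxtimes_def)

lemma mult_S: "(a\<^sub>1, b\<^sub>1) \<otimes>\<^bsub>S\<^esub> (a\<^sub>2, b\<^sub>2) = (\<alpha> b\<^sub>2 (a\<^sub>1, a\<^sub>2) \<oplus>\<^bsub>A\<^esub> \<beta> (b\<^sub>1, b\<^sub>2) a\<^sub>2, b\<^sub>1 \<otimes>\<^bsub>B\<^esub> b\<^sub>2)"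
  by (simp add: boxtimes_def)

lemma psi_closed: "\<lbrakk>b \<in> carrier B; a \<in> carrier A\<rbrakk> \<Longrightarrow> \<psi> b a \<in> carrier A"
  using psi_iso by (fastforce simp: iso_def hom_def)

lemma psi_add: "\<lbrakk>b \<in> carrier B; x \<in> carrier A; y \<in> carrier A\<rbrakk> \<Longrightarrow> \<psi> b (x \<oplus>\<^bsub>A\<^esub> y) = \<psi> b x \<oplus>\<^bsub>A\<^esub> \<psi> b y"
  using psi_iso by (fastforce simp: iso_def hom_def)

lemma psi_inj: "b \<in> carrier B \<Longrightarrow> inj_on (\<psi> b) (carrier A)"
  using psi_iso by (fastforce simp: iso_def bij_betw_def)

lemma psi_zero: "b \<in> carrier B \<Longrightarrow> \<psi> b \<zero>\<^bsub>A\<^esub> = \<zero>\<^bsub>A\<^esub>"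
  using psi_add[of b "\<zero>\<^bsub>A\<^esub>" "\<zero>\<^bsub>A\<^esub>"] psi_closed[of b "\<zero>\<^bsub>A\<^esub>"]
  by (metis A.add.l_cancel_one A.add.one_closed A.add.r_one)

lemma alpha_closed:
  "\<lbrakk>b \<in> carrier B; x \<in> carrier A; y \<in> carrier A\<rbrakk> \<Longrightarrow> \<alpha> b (x, y) \<in> carrier A"
  using alpha_maps by blast

lemma beta_closed:
  "\<lbrakk>b \<in> carrier B; c \<in> carrier B; x \<in> carrier A\<rbrakk> \<Longrightarrow> \<beta> (b, c) x \<in> carrier A"
  using beta_maps by blast

lemma alpha_zero: "\<lbrakk>b \<in> carrier B; a \<in> carrier A\<rbrakk> \<Longrightarrow> \<alpha> b (\<zero>\<^bsub>A\<^esub>, a) = \<zero>\<^bsub>A\<^esub>"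
  using alpha_add[of b "\<zero>\<^bsub>A\<^esub>" "\<zero>\<^bsub>A\<^esub>" a] alpha_closed[of b "\<zero>\<^bsub>A\<^esub>" a]
  by (metis A.add.l_cancel_one A.add.one_closed A.add.r_one)

lemmas closed = psi_closed alpha_closed beta_closed A.mult_closed B.mult_closed
lemmas zeros = psi_zero alpha_zero alpha_zero_index beta_zero_index beta_zero B.zero_mult

lemma nearring_hom_complement: "(\<lambda>b. (\<zero>\<^bsub>A\<^esub>, b)) \<in> nearring_hom B S"
  by (simp add: nearring_hom_def hom_def carrier_S add_S mult_S zeros)

lemma nearring_hom_retraction: "(\<lambda>x. (\<zero>\<^bsub>A\<^esub>, snd x)) \<in> nearring_hom S S"
  by (auto simp: nearring_hom_def hom_def carrier_S add_S mult_S zeros closed)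

text \<open>
  The map \<open>a \<mapsto> (a, 0)\<close> is additive only if \<open>\<psi>\<^sub>0\<close> is the identity; this is the law \<open>0 + x = x\<close> in
  \<open>A \<boxtimes> B\<close>. The rest comes from the retraction \<open>(a, b) \<mapsto> (0, b)\<close>.
\<close>

lemma outer_semidirect_sum_boxtimes:
  assumes "nearring S"
  shows "outer_semidirect_sum S A (\<lambda>a. (a, \<zero>\<^bsub>B\<^esub>)) B (\<lambda>b. (\<zero>\<^bsub>A\<^esub>, b))"
proof -
  interpret S: nearring S by (rule assms)
  have psi0: "\<psi> \<zero>\<^bsub>B\<^esub> a = a" if "a \<in> carrier A" for a
    using S.add.l_one[of "(a, \<zero>\<^bsub>B\<^esub>)"] that by (simp add: carrier_S zero_S add_S psi_closed)
  have A: "nearring_embedding A S (\<lambda>a. (a, \<zero>\<^bsub>B\<^esub>))"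
    by (auto simp: nearring_embedding_def nearring_hom_def hom_def inj_on_def carrier_S add_S
        mult_S zeros closed psi0)
  have B: "nearring_embedding B S (\<lambda>b. (\<zero>\<^bsub>A\<^esub>, b))"
    using nearring_hom_complement by (simp add: nearring_embedding_def inj_on_def)
  let ?e = "\<lambda>x. (\<zero>\<^bsub>A\<^esub>, snd x)"
  have "internal_semidirect_sum S (a_kernel S S ?e) (?e ` carrier S)"
    by (rule internal_semidirect_sum_of_retraction[OF assms nearring_hom_retraction]) simp
  moreover have "a_kernel S S ?e = (\<lambda>a. (a, \<zero>\<^bsub>B\<^esub>)) ` carrier A"
    by (auto simp: a_kernel_def kernel_def carrier_S zero_S)
  moreover have "?e ` carrier S = (\<lambda>b. (\<zero>\<^bsub>A\<^esub>, b)) ` carrier B"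
    by (force simp: carrier_S)
  ultimately show ?thesis
    using A B by (simp add: outer_semidirect_sum_def)
qed

section \<open>When the sum is a nearring\<close>

definition sum_conditions :: bool where
  "sum_conditions \<longleftrightarrow>
    (\<forall>a\<^sub>1\<in>carrier A. \<forall>a\<^sub>2\<in>carrier A. \<forall>a\<^sub>3\<in>carrier A.
     \<forall>b\<^sub>1\<in>carrier B. \<forall>b\<^sub>2\<in>carrier B. \<forall>b\<^sub>3\<in>carrier B.
       \<psi> b\<^sub>1 (\<psi> b\<^sub>2 a\<^sub>1) = \<psi> (b\<^sub>1 \<oplus>\<^bsub>B\<^esub> b\<^sub>2) a\<^sub>1 \<and>
       \<alpha> b\<^sub>3 (\<beta> (b\<^sub>1, b\<^sub>2) a\<^sub>2, a\<^sub>3) \<oplus>\<^bsub>A\<^esub> \<beta> (b\<^sub>1 \<otimes>\<^bsub>B\<^esub> b\<^sub>2, b\<^sub>3) a\<^sub>3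
         = \<beta> (b\<^sub>1, b\<^sub>2 \<otimes>\<^bsub>B\<^esub> b\<^sub>3) (\<alpha> b\<^sub>3 (a\<^sub>2, a\<^sub>3) \<oplus>\<^bsub>A\<^esub> \<beta> (b\<^sub>2, b\<^sub>3) a\<^sub>3) \<and>
       \<alpha> b\<^sub>3 (\<alpha> b\<^sub>2 (a\<^sub>1, a\<^sub>2), a\<^sub>3)
         = \<alpha> (b\<^sub>2 \<otimes>\<^bsub>B\<^esub> b\<^sub>3) (a\<^sub>1, \<alpha> b\<^sub>3 (a\<^sub>2, a\<^sub>3) \<oplus>\<^bsub>A\<^esub> \<beta> (b\<^sub>2, b\<^sub>3) a\<^sub>3) \<and>
       \<beta> (b\<^sub>1 \<oplus>\<^bsub>B\<^esub> b\<^sub>2, b\<^sub>3) a\<^sub>1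
         = \<beta> (b\<^sub>1, b\<^sub>3) a\<^sub>1 \<oplus>\<^bsub>A\<^esub> \<psi> (b\<^sub>1 \<otimes>\<^bsub>B\<^esub> b\<^sub>3) (\<beta> (b\<^sub>2, b\<^sub>3) a\<^sub>1) \<and>
       \<alpha> b\<^sub>3 (\<psi> b\<^sub>1 a\<^sub>2, a\<^sub>3) \<oplus>\<^bsub>A\<^esub> \<beta> (b\<^sub>1, b\<^sub>3) a\<^sub>3
         = \<beta> (b\<^sub>1, b\<^sub>3) a\<^sub>3 \<oplus>\<^bsub>A\<^esub> \<psi> (b\<^sub>1 \<otimes>\<^bsub>B\<^esub> b\<^sub>3) (\<alpha> b\<^sub>3 (a\<^sub>2, a\<^sub>3)))"

text \<open>
  Each condition is the \<open>A\<close>-component of one nearring law, at pairs in which the entries set to \<open>0\<close>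
  are chosen so that the terms belonging to the other conditions vanish.
\<close>

lemma sum_conditions_if_nearring:
  assumes "nearring S"
  shows sum_conditions
  unfolding sum_conditions_def
proof (intro ballI conjI)
  interpret S: nearring S by (rule assms)
  fix a\<^sub>1 a\<^sub>2 a\<^sub>3 b\<^sub>1 b\<^sub>2 b\<^sub>3
  assume a: "a\<^sub>1 \<in> carrier A" "a\<^sub>2 \<in> carrier A" "a\<^sub>3 \<in> carrier A"
    and b: "b\<^sub>1 \<in> carrier B" "b\<^sub>2 \<in> carrier B" "b\<^sub>3 \<in> carrier B"
  show "\<psi> b\<^sub>1 (\<psi> b\<^sub>2 a\<^sub>1) = \<psi> (b\<^sub>1 \<oplus>\<^bsub>B\<^esub> b\<^sub>2) a\<^sub>1"
    using S.add.m_assoc[of "(\<zero>\<^bsub>A\<^esub>, b\<^sub>1)" "(\<zero>\<^bsub>A\<^esub>, b\<^sub>2)" "(a\<^sub>1, \<zero>\<^bsub>B\<^esub>)"] a b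
    by (simp add: carrier_S add_S zeros closed)
  show "\<alpha> b\<^sub>3 (\<beta> (b\<^sub>1, b\<^sub>2) a\<^sub>2, a\<^sub>3) \<oplus>\<^bsub>A\<^esub> \<beta> (b\<^sub>1 \<otimes>\<^bsub>B\<^esub> b\<^sub>2, b\<^sub>3) a\<^sub>3
      = \<beta> (b\<^sub>1, b\<^sub>2 \<otimes>\<^bsub>B\<^esub> b\<^sub>3) (\<alpha> b\<^sub>3 (a\<^sub>2, a\<^sub>3) \<oplus>\<^bsub>A\<^esub> \<beta> (b\<^sub>2, b\<^sub>3) a\<^sub>3)"
    using S.mult_assoc[of "(\<zero>\<^bsub>A\<^esub>, b\<^sub>1)" "(a\<^sub>2, b\<^sub>2)" "(a\<^sub>3, b\<^sub>3)"] a b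
    by (simp add: carrier_S mult_S zeros closed)
  show "\<alpha> b\<^sub>3 (\<alpha> b\<^sub>2 (a\<^sub>1, a\<^sub>2), a\<^sub>3)
      = \<alpha> (b\<^sub>2 \<otimes>\<^bsub>B\<^esub> b\<^sub>3) (a\<^sub>1, \<alpha> b\<^sub>3 (a\<^sub>2, a\<^sub>3) \<oplus>\<^bsub>A\<^esub> \<beta> (b\<^sub>2, b\<^sub>3) a\<^sub>3)"
    using S.mult_assoc[of "(a\<^sub>1, \<zero>\<^bsub>B\<^esub>)" "(a\<^sub>2, b\<^sub>2)" "(a\<^sub>3, b\<^sub>3)"] a b
    by (simp add: carrier_S mult_S zeros closed)
  show "\<beta> (b\<^sub>1 \<oplus>\<^bsub>B\<^esub> b\<^sub>2, b\<^sub>3) a\<^sub>1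
      = \<beta> (b\<^sub>1, b\<^sub>3) a\<^sub>1 \<oplus>\<^bsub>A\<^esub> \<psi> (b\<^sub>1 \<otimes>\<^bsub>B\<^esub> b\<^sub>3) (\<beta> (b\<^sub>2, b\<^sub>3) a\<^sub>1)"
    using S.right_distrib[of "(\<zero>\<^bsub>A\<^esub>, b\<^sub>1)" "(\<zero>\<^bsub>A\<^esub>, b\<^sub>2)" "(a\<^sub>1, b\<^sub>3)"] a b
    by (simp add: carrier_S add_S mult_S zeros closed)
  show "\<alpha> b\<^sub>3 (\<psi> b\<^sub>1 a\<^sub>2, a\<^sub>3) \<oplus>\<^bsub>A\<^esub> \<beta> (b\<^sub>1, b\<^sub>3) a\<^sub>3
      = \<beta> (b\<^sub>1, b\<^sub>3) a\<^sub>3 \<oplus>\<^bsub>A\<^esub> \<psi> (b\<^sub>1 \<otimes>\<^bsub>B\<^esub> b\<^sub>3) (\<alpha> b\<^sub>3 (a\<^sub>2, a\<^sub>3))"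
    using S.right_distrib[of "(\<zero>\<^bsub>A\<^esub>, b\<^sub>1)" "(a\<^sub>2, \<zero>\<^bsub>B\<^esub>)" "(a\<^sub>3, b\<^sub>3)"] a b
    by (simp add: carrier_S add_S mult_S zeros closed)
qed

text \<open>
  The conditions add up to the laws for general pairs. Apart from associativity, the point to settle
  for the additive group is that \<open>\<psi>\<^sub>0\<close> is the identity, so that \<open>(0, 0)\<close> is neutral.
\<close>

lemma nearring_if_sum_conditions:
  assumes sum_conditions
  shows "nearring S"
proof -
  have G2: "\<psi> b\<^sub>1 (\<psi> b\<^sub>2 a) = \<psi> (b\<^sub>1 \<oplus>\<^bsub>B\<^esub> b\<^sub>2) a"
    and D1: "\<beta> (b\<^sub>1 \<oplus>\<^bsub>B\<^esub> b\<^sub>2, b\<^sub>3) a = \<beta> (b\<^sub>1, b\<^sub>3) a \<oplus>\<^bsub>A\<^esub> \<psi> (b\<^sub>1 \<otimes>\<^bsub>B\<^esub> b\<^sub>3) (\<beta> (b\<^sub>2, b\<^sub>3) a)"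
    if "a \<in> carrier A" "b\<^sub>1 \<in> carrier B" "b\<^sub>2 \<in> carrier B" "b\<^sub>3 \<in> carrier B" for a b\<^sub>1 b\<^sub>2 b\<^sub>3
    using assms that unfolding sum_conditions_def by blast+
  have A1: "\<alpha> b\<^sub>3 (\<beta> (b\<^sub>1, b\<^sub>2) a\<^sub>2, a\<^sub>3) \<oplus>\<^bsub>A\<^esub> \<beta> (b\<^sub>1 \<otimes>\<^bsub>B\<^esub> b\<^sub>2, b\<^sub>3) a\<^sub>3
        = \<beta> (b\<^sub>1, b\<^sub>2 \<otimes>\<^bsub>B\<^esub> b\<^sub>3) (\<alpha> b\<^sub>3 (a\<^sub>2, a\<^sub>3) \<oplus>\<^bsub>A\<^esub> \<beta> (b\<^sub>2, b\<^sub>3) a\<^sub>3)"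
    and D2: "\<alpha> b\<^sub>3 (\<psi> b\<^sub>1 a\<^sub>2, a\<^sub>3) \<oplus>\<^bsub>A\<^esub> \<beta> (b\<^sub>1, b\<^sub>3) a\<^sub>3
        = \<beta> (b\<^sub>1, b\<^sub>3) a\<^sub>3 \<oplus>\<^bsub>A\<^esub> \<psi> (b\<^sub>1 \<otimes>\<^bsub>B\<^esub> b\<^sub>3) (\<alpha> b\<^sub>3 (a\<^sub>2, a\<^sub>3))"
    if "a\<^sub>2 \<in> carrier A" "a\<^sub>3 \<in> carrier A" "b\<^sub>1 \<in> carrier B" "b\<^sub>2 \<in> carrier B" "b\<^sub>3 \<in> carrier B"
    for a\<^sub>2 a\<^sub>3 b\<^sub>1 b\<^sub>2 b\<^sub>3
    using assms that unfolding sum_conditions_def by blast+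
  have A2: "\<alpha> b\<^sub>3 (\<alpha> b\<^sub>2 (a\<^sub>1, a\<^sub>2), a\<^sub>3)
        = \<alpha> (b\<^sub>2 \<otimes>\<^bsub>B\<^esub> b\<^sub>3) (a\<^sub>1, \<alpha> b\<^sub>3 (a\<^sub>2, a\<^sub>3) \<oplus>\<^bsub>A\<^esub> \<beta> (b\<^sub>2, b\<^sub>3) a\<^sub>3)"
    if "a\<^sub>1 \<in> carrier A" "a\<^sub>2 \<in> carrier A" "a\<^sub>3 \<in> carrier A" "b\<^sub>2 \<in> carrier B" "b\<^sub>3 \<in> carrier B"
    for a\<^sub>1 a\<^sub>2 a\<^sub>3 b\<^sub>2 b\<^sub>3
    using assms that unfolding sum_conditions_def by blast
  \<comment> \<open>\<open>\<psi>\<^sub>0\<close> is idempotent by \<open>(G\<^sub>2)\<close>, and an injective idempotent map is the identity.\<close>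
  have psi0: "\<psi> \<zero>\<^bsub>B\<^esub> a = a" if "a \<in> carrier A" for a
  proof (rule inj_onD[OF psi_inj[of "\<zero>\<^bsub>B\<^esub>"]])
    show "\<psi> \<zero>\<^bsub>B\<^esub> (\<psi> \<zero>\<^bsub>B\<^esub> a) = \<psi> \<zero>\<^bsub>B\<^esub> a"
      using G2[of a "\<zero>\<^bsub>B\<^esub>" "\<zero>\<^bsub>B\<^esub>" "\<zero>\<^bsub>B\<^esub>"] that by simp
  qed (simp_all add: that closed)
  show ?thesis
  proof (rule nearring.intro)
    show "group (add_monoid S)"
    proof (rule groupI)
      fix x y assume "x \<in> carrier (add_monoid S)" "y \<in> carrier (add_monoid S)"
      then show "x \<otimes>\<^bsub>add_monoid S\<^esub> y \<in> carrier (add_monoid S)"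
        by (auto simp: carrier_S add_S closed)
    next
      show "\<one>\<^bsub>add_monoid S\<^esub> \<in> carrier (add_monoid S)"
        by (simp add: carrier_S zero_S)
    next
      fix x y z
      assume "x \<in> carrier (add_monoid S)" "y \<in> carrier (add_monoid S)"
        "z \<in> carrier (add_monoid S)"
      then show "x \<otimes>\<^bsub>add_monoid S\<^esub> y \<otimes>\<^bsub>add_monoid S\<^esub> z = x \<otimes>\<^bsub>add_monoid S\<^esub> (y \<otimes>\<^bsub>add_monoid S\<^esub> z)"
        by (auto simp: carrier_S add_S closed psi_add G2[where b\<^sub>3 = "\<zero>\<^bsub>B\<^esub>"] A.add.m_assoc
            B.add.m_assoc)
    next
      fix x assume "x \<in> carrier (add_monoid S)"
      then show "\<one>\<^bsub>add_monoid S\<^esub> \<otimes>\<^bsub>add_monoid S\<^esub> x = x"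
        by (auto simp: carrier_S zero_S add_S psi0)
    next
      fix x assume "x \<in> carrier (add_monoid S)"
      then obtain a b where x: "x = (a, b)" and ab: "a \<in> carrier A" "b \<in> carrier B"
        by (auto simp: carrier_S)
      \<comment> \<open>Solving \<open>(c, d) + (a, b) = 0\<close> gives \<open>d = -b\<close> and then \<open>c = -\<psi>\<^sub>d(a)\<close>.\<close>
      have "(\<ominus>\<^bsub>A\<^esub> \<psi> (\<ominus>\<^bsub>B\<^esub> b) a, \<ominus>\<^bsub>B\<^esub> b) \<in> carrier S"
        and "(\<ominus>\<^bsub>A\<^esub> \<psi> (\<ominus>\<^bsub>B\<^esub> b) a, \<ominus>\<^bsub>B\<^esub> b) \<oplus>\<^bsub>S\<^esub> x = \<zero>\<^bsub>S\<^esub>"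
        using ab by (simp_all add: x carrier_S zero_S add_S closed A.add.l_inv B.add.l_inv)
      then show "\<exists>y\<in>carrier (add_monoid S). y \<otimes>\<^bsub>add_monoid S\<^esub> x = \<one>\<^bsub>add_monoid S\<^esub>"
        by auto
    qed
  next
    fix x y assume "x \<in> carrier S" "y \<in> carrier S"
    then show "x \<otimes>\<^bsub>S\<^esub> y \<in> carrier S"
      by (auto simp: carrier_S mult_S closed)
  next
    fix x y z assume "x \<in> carrier S" "y \<in> carrier S" "z \<in> carrier S"
    \<comment> \<open>\<open>\<alpha>\<close> is additive in its first argument: \<open>(A\<^sub>2)\<close> treats the summand \<open>\<alpha>\<close>, \<open>(A\<^sub>1)\<close> the rest.\<close>
    then show "(x \<otimes>\<^bsub>S\<^esub> y) \<otimes>\<^bsub>S\<^esub> z = x \<otimes>\<^bsub>S\<^esub> (y \<otimes>\<^bsub>S\<^esub> z)"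
      by (auto simp: carrier_S mult_S closed alpha_add A.add.m_assoc B.mult_assoc A1 A2)
  next
    fix x y z assume "x \<in> carrier S" "y \<in> carrier S" "z \<in> carrier S"
    then obtain a\<^sub>1 b\<^sub>1 a\<^sub>2 b\<^sub>2 a\<^sub>3 b\<^sub>3 where
      xyz: "x = (a\<^sub>1, b\<^sub>1)" "y = (a\<^sub>2, b\<^sub>2)" "z = (a\<^sub>3, b\<^sub>3)"
      and a: "a\<^sub>1 \<in> carrier A" "a\<^sub>2 \<in> carrier A" "a\<^sub>3 \<in> carrier A"
      and b: "b\<^sub>1 \<in> carrier B" "b\<^sub>2 \<in> carrier B" "b\<^sub>3 \<in> carrier B"
      by (auto simp: carrier_S)
    \<comment> \<open>\<open>(D\<^sub>1)\<close> splits \<open>\<beta>\<close> so that \<open>(D\<^sub>2)\<close> can move \<open>\<alpha>\<close> past its first summand.\<close>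
    have "\<alpha> b\<^sub>3 (\<psi> b\<^sub>1 a\<^sub>2, a\<^sub>3) \<oplus>\<^bsub>A\<^esub> \<beta> (b\<^sub>1 \<oplus>\<^bsub>B\<^esub> b\<^sub>2, b\<^sub>3) a\<^sub>3
        = (\<alpha> b\<^sub>3 (\<psi> b\<^sub>1 a\<^sub>2, a\<^sub>3) \<oplus>\<^bsub>A\<^esub> \<beta> (b\<^sub>1, b\<^sub>3) a\<^sub>3) \<oplus>\<^bsub>A\<^esub> \<psi> (b\<^sub>1 \<otimes>\<^bsub>B\<^esub> b\<^sub>3) (\<beta> (b\<^sub>2, b\<^sub>3) a\<^sub>3)"
      using a b by (simp add: D1 closed A.add.m_assoc)
    also have "\<dots> = \<beta> (b\<^sub>1, b\<^sub>3) a\<^sub>3 \<oplus>\<^bsub>A\<^esub> \<psi> (b\<^sub>1 \<otimes>\<^bsub>B\<^esub> b\<^sub>3) (\<alpha> b\<^sub>3 (a\<^sub>2, a\<^sub>3) \<oplus>\<^bsub>A\<^esub> \<beta> (b\<^sub>2, b\<^sub>3) a\<^sub>3)"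
      using a b D2[OF a(2,3) b] by (simp add: closed psi_add A.add.m_assoc)
    finally show "(x \<oplus>\<^bsub>S\<^esub> y) \<otimes>\<^bsub>S\<^esub> z = x \<otimes>\<^bsub>S\<^esub> z \<oplus>\<^bsub>S\<^esub> y \<otimes>\<^bsub>S\<^esub> z"
      using a b
      by (simp add: xyz add_S mult_S closed alpha_add A.add.m_assoc B.right_distrib)
  qed
qed

end

theorem proposition3p2:
  fixes A :: "('a, 'm) ring_scheme" and B :: "('b, 'n) ring_scheme"
    and \<psi> :: "'b \<Rightarrow> 'a \<Rightarrow> 'a"
    and \<alpha> :: "'b \<Rightarrow> 'a \<times> 'a \<Rightarrow> 'a"
    and \<beta> :: "'b \<times> 'b \<Rightarrow> 'a \<Rightarrow> 'a"
  assumes "nearring A" and "nearring B"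
    and "\<psi> \<in> carrier B \<rightarrow> iso (add_monoid A) (add_monoid A)"
    and "\<alpha> \<in> carrier B \<rightarrow> (carrier A \<times> carrier A \<rightarrow> carrier A)"
    and "\<beta> \<in> carrier B \<times> carrier B \<rightarrow> (carrier A \<rightarrow> carrier A)"
    and "\<And>b a\<^sub>1 a\<^sub>2 a. \<lbrakk>b \<in> carrier B; a\<^sub>1 \<in> carrier A; a\<^sub>2 \<in> carrier A; a \<in> carrier A\<rbrakk> \<Longrightarrow>
           \<alpha> b (a\<^sub>1 \<oplus>\<^bsub>A\<^esub> a\<^sub>2, a) = \<alpha> b (a\<^sub>1, a) \<oplus>\<^bsub>A\<^esub> \<alpha> b (a\<^sub>2, a)"
    and "\<And>a\<^sub>1 a\<^sub>2. \<lbrakk>a\<^sub>1 \<in> carrier A; a\<^sub>2 \<in> carrier A\<rbrakk> \<Longrightarrow> \<alpha> \<zero>\<^bsub>B\<^esub> (a\<^sub>1, a\<^sub>2) = a\<^sub>1 \<otimes>\<^bsub>A\<^esub> a\<^sub>2"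
    and "\<And>b a. \<lbrakk>b \<in> carrier B; a \<in> carrier A\<rbrakk> \<Longrightarrow> \<beta> (\<zero>\<^bsub>B\<^esub>, b) a = \<zero>\<^bsub>A\<^esub>"
    and "\<And>b\<^sub>1 b\<^sub>2. \<lbrakk>b\<^sub>1 \<in> carrier B; b\<^sub>2 \<in> carrier B\<rbrakk> \<Longrightarrow> \<beta> (b\<^sub>1, b\<^sub>2) \<zero>\<^bsub>A\<^esub> = \<zero>\<^bsub>A\<^esub>"
  shows "outer_semidirect_sum (boxtimes A B \<psi> \<alpha> \<beta>) A (\<lambda>a. (a, \<zero>\<^bsub>B\<^esub>)) B (\<lambda>b. (\<zero>\<^bsub>A\<^esub>, b)) \<longleftrightarrow>
    (\<forall>a\<^sub>1\<in>carrier A. \<forall>a\<^sub>2\<in>carrier A. \<forall>a\<^sub>3\<in>carrier A.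
     \<forall>b\<^sub>1\<in>carrier B. \<forall>b\<^sub>2\<in>carrier B. \<forall>b\<^sub>3\<in>carrier B.
       \<psi> b\<^sub>1 (\<psi> b\<^sub>2 a\<^sub>1) = \<psi> (b\<^sub>1 \<oplus>\<^bsub>B\<^esub> b\<^sub>2) a\<^sub>1 \<and>
       \<alpha> b\<^sub>3 (\<beta> (b\<^sub>1, b\<^sub>2) a\<^sub>2, a\<^sub>3) \<oplus>\<^bsub>A\<^esub> \<beta> (b\<^sub>1 \<otimes>\<^bsub>B\<^esub> b\<^sub>2, b\<^sub>3) a\<^sub>3
         = \<beta> (b\<^sub>1, b\<^sub>2 \<otimes>\<^bsub>B\<^esub> b\<^sub>3) (\<alpha> b\<^sub>3 (a\<^sub>2, a\<^sub>3) \<oplus>\<^bsub>A\<^esub> \<beta> (b\<^sub>2, b\<^sub>3) a\<^sub>3) \<and>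
       \<alpha> b\<^sub>3 (\<alpha> b\<^sub>2 (a\<^sub>1, a\<^sub>2), a\<^sub>3)
         = \<alpha> (b\<^sub>2 \<otimes>\<^bsub>B\<^esub> b\<^sub>3) (a\<^sub>1, \<alpha> b\<^sub>3 (a\<^sub>2, a\<^sub>3) \<oplus>\<^bsub>A\<^esub> \<beta> (b\<^sub>2, b\<^sub>3) a\<^sub>3) \<and>
       \<beta> (b\<^sub>1 \<oplus>\<^bsub>B\<^esub> b\<^sub>2, b\<^sub>3) a\<^sub>1
         = \<beta> (b\<^sub>1, b\<^sub>3) a\<^sub>1 \<oplus>\<^bsub>A\<^esub> \<psi> (b\<^sub>1 \<otimes>\<^bsub>B\<^esub> b\<^sub>3) (\<beta> (b\<^sub>2, b\<^sub>3) a\<^sub>1) \<and>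
       \<alpha> b\<^sub>3 (\<psi> b\<^sub>1 a\<^sub>2, a\<^sub>3) \<oplus>\<^bsub>A\<^esub> \<beta> (b\<^sub>1, b\<^sub>3) a\<^sub>3
         = \<beta> (b\<^sub>1, b\<^sub>3) a\<^sub>3 \<oplus>\<^bsub>A\<^esub> \<psi> (b\<^sub>1 \<otimes>\<^bsub>B\<^esub> b\<^sub>3) (\<alpha> b\<^sub>3 (a\<^sub>2, a\<^sub>3)))"
proof -
  interpret split_sum A B \<psi> \<alpha> \<beta>
    using assms by (simp add: split_sum_def split_sum_axioms_def)
  have "outer_semidirect_sum S A (\<lambda>a. (a, \<zero>\<^bsub>B\<^esub>)) B (\<lambda>b. (\<zero>\<^bsub>A\<^esub>, b)) \<longleftrightarrow> nearring S"
    using outer_semidirect_sum_boxtimes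
    by (auto simp: outer_semidirect_sum_def internal_semidirect_sum_def)
  also have "\<dots> \<longleftrightarrow> sum_conditions"
    using sum_conditions_if_nearring nearring_if_sum_conditions by blast
  finally show ?thesis
    unfolding sum_conditions_def .
qed

end
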